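(* Let $\mathbb{D}$ be a strict double category and let $F:\mathbb{D}\to\mathbb{E}$ be a lax double functor. (i) For every proarrow $m:x\nrightarrow y$ in $\mathbb{D}$, the proarrow $Fm:Fx\nrightarrow Fy$ together with the laxators $F_{x,m}:F\mathrm{id}_x\odot Fm\to Fm$ and $F_{m,y}:Fm\odot F\mathrm{id}_y\to Fm$ is a profunctor in $\mathbb{E}$ from the category $(Fx,F\mathrm{id}_x,F_{x,x},F_x)$ to the category $(Fy,F\mathrm{id}_y,F_{y,y},F_y)$. (ii) For every cell $\alpha:m\to n$ over $(f,g)$ in $\mathbb{D}$, with $m:x\nrightarrow y$, $n:w\nrightarrow z$, the cell $F\alpha:Fm\to Fn$ over $(Ff,Fg)$ in $\mathbb{E}$ is a natural transformation from the profunctor $(Fm,F_{x,m},F_{m,y})$ to $(Fn,F_{w,n},F_{n,z})$ with source $(Ff,F\mathrm{id}_f)$ and target $(Fg,F\mathrm{id}_g)$. Moreover, these assignments are functorial with respect to composition in $\mathbb{D}_1$.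
   Context: Double categories are pseudo: strict in the direction of arrows, weak in the direction of proarrows. A double category $\mathbb{D}$ has underlying categories $\mathbb{D}_0$ (objects and arrows) and $\mathbb{D}_1$ (proarrows, written $m: x \nrightarrow y$, and cells). A cell $\alpha: m \to n$ from $m: x \nrightarrow y$ to $n: w \nrightarrow z$ over $(f,g)$ has source arrow $f: x\to w$ and target arrow $g: y \to z$; it is globular if $f,g$ are identities. Composition in $\mathbb{D}_0,\mathbb{D}_1$ is written $\cdot$ in diagrammatic order; external composition is written $\odot$ in diagrammatic order, with external identities $\mathrm{id}_x,\mathrm{id}_f$. Coherence isomorphisms for $\odot$ are suppressed in formulas. Lax double functor $F:\mathbb{D}\to\mathbb{E}$: functors $F_0,F_1$ compatible with source and target, with globular laxators $F_{m,n}:Fm\odot Fn\to F(m\odot n)$ and unitors $F_x:\mathrm{id}_{Fx}\to F\mathrm{id}_x$, natural ($(F\alpha\odot F\beta)\cdot F_{m',n'}=F_{m,n}\cdot F(\alpha\odot\beta)$, $\mathrm{id}_{Ff}\cdot F_y=F_x\cdot F\mathrm{id}_f$), associative and unital; $F_{x,m}=F_{\mathrm{id}_x,m}$, $F_{m,y}=F_{m,\mathrm{id}_y}$, $F_{x,x}=F_{\mathrm{id}_x,\mathrm{id}_x}$. A category (object) in a double category is $(x,r,\mu,\eta)$ with $r:x\nrightarrow x$ and globular cells $\mu:r\odot r\to r$, $\eta:\mathrm{id}_x\to r$, associative and unital. A functor $(f,\phi):(x,r,\mu,\eta)\to(y,s,\nu,\theta)$ is an arrow $f:x\to y$ with a cell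 $\phi:r\to s$ over $(f,f)$ such that $(\phi\odot\phi)\cdot\nu=\mu\cdot\phi$ and $\mathrm{id}_f\cdot\theta=\eta\cdot\phi$. A profunctor (bimodule) from $(x,r,\mu,\eta)$ to $(y,s,\nu,\theta)$ is a proarrow $m:x\nrightarrow y$ with globular cells $\lambda:r\odot m\to m$, $\rho:m\odot s\to m$ such that $(\mu\odot1_m)\cdot\lambda=(1_r\odot\lambda)\cdot\lambda$, $(\eta\odot1_m)\cdot\lambda=1_m$, similarly for $\rho$, and $(\lambda\odot1_s)\cdot\rho=(1_r\odot\rho)\cdot\lambda$. A natural transformation from a profunctor $(m,\lambda^m,\rho^m)$ to $(n,\lambda^n,\rho^n)$ with source functor $(f,\phi)$ and target functor $(g,\psi)$ is a cell $\alpha:m\to n$ over $(f,g)$ with $(\phi\odot\alpha)\cdot\lambda^n=\lambda^m\cdot\alpha$ and $(\alpha\odot\psi)\cdot\rho^n=\rho^m\cdot\alpha$. *)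

theory Defs
  imports Main
begin

text \<open>
  Categories have carrier sets of objects and arrows inside arbitrary types; operations are total
  functions that are only constrained on the carriers. All composition is written in diagrammatic
  order.
\<close>

section \<open>Categories and functors\<close>

record ('o, 'a) cat =
  Obj :: "'o set"
  Arr :: "'a set"
  Dom :: "'a \<Rightarrow> 'o"
  Cod :: "'a \<Rightarrow> 'o"
  Idt :: "'o \<Rightarrow> 'a"
  Comp :: "'a \<Rightarrow> 'a \<Rightarrow> 'a" (infixl "\<cdot>\<index>" 70)

definition hom :: "('o, 'a) cat \<Rightarrow> 'o \<Rightarrow> 'o \<Rightarrow> 'a set" where
  "hom C a b = {f \<in> Arr C. Dom C f = a \<and> Cod C f = b}"

locale category =
  fixes C :: "('o, 'a) cat" (structure)
  assumes Dom_closed: "f \<in> Arr C \<Longrightarrow> Dom C f \<in> Obj C"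
    and Cod_closed: "f \<in> Arr C \<Longrightarrow> Cod C f \<in> Obj C"
    and Idt_hom: "a \<in> Obj C \<Longrightarrow> Idt C a \<in> hom C a a"
    and Comp_hom: "f \<in> hom C a b \<Longrightarrow> g \<in> hom C b c \<Longrightarrow> f \<cdot> g \<in> hom C a c"
    and Idt_left: "f \<in> hom C a b \<Longrightarrow> Idt C a \<cdot> f = f"
    and Idt_right: "f \<in> hom C a b \<Longrightarrow> f \<cdot> Idt C b = f"
    and Comp_assoc: "f \<in> hom C a b \<Longrightarrow> g \<in> hom C b c \<Longrightarrow> h \<in> hom C c d \<Longrightarrow>
      (f \<cdot> g) \<cdot> h = f \<cdot> (g \<cdot> h)"

definition iso_arr :: "('o, 'a) cat \<Rightarrow> 'a \<Rightarrow> bool" where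
  "iso_arr C f \<longleftrightarrow> f \<in> Arr C \<and>
    (\<exists>g \<in> hom C (Cod C f) (Dom C f).
      f \<cdot>\<^bsub>C\<^esub> g = Idt C (Dom C f) \<and> g \<cdot>\<^bsub>C\<^esub> f = Idt C (Cod C f))"

record ('o, 'a, 'p, 'b) functor_data =
  onO :: "'o \<Rightarrow> 'p"
  onA :: "'a \<Rightarrow> 'b"

locale cat_functor = C: category C + D: category D
  for C :: "('o, 'a) cat" and D :: "('p, 'b) cat" +
  fixes F :: "('o, 'a, 'p, 'b) functor_data"
  assumes onO_closed: "a \<in> Obj C \<Longrightarrow> onO F a \<in> Obj D"
    and onA_hom: "f \<in> hom C a b \<Longrightarrow> onA F f \<in> hom D (onO F a) (onO F b)"
    and onA_Idt: "a \<in> Obj C \<Longrightarrow> onA F (Idt C a) = Idt D (onO F a)"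
    and onA_Comp: "f \<in> hom C a b \<Longrightarrow> g \<in> hom C b c \<Longrightarrow>
      onA F (f \<cdot>\<^bsub>C\<^esub> g) = onA F f \<cdot>\<^bsub>D\<^esub> onA F g"


section \<open>Double categories\<close>

text \<open>
  \<open>D0\<close> consists of objects and arrows, \<open>D1\<close> of proarrows and cells. \<open>Unit\<close> and \<open>Hor\<close> are the
  external identity and external composition functors; \<open>Asc\<close>, \<open>Lun\<close>, \<open>Run\<close> are the coherence cells
  \<open>(m \<odot> n) \<odot> p \<rightarrow> m \<odot> (n \<odot> p)\<close>, \<open>id \<odot> m \<rightarrow> m\<close> and \<open>m \<odot> id \<rightarrow> m\<close>.
\<close>

record ('o, 'a, 'p, 'c) dblcat =
  D0 :: "('o, 'a) cat"
  D1 :: "('p, 'c) cat"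
  Src :: "('p, 'c, 'o, 'a) functor_data"
  Tgt :: "('p, 'c, 'o, 'a) functor_data"
  Unit :: "('o, 'a, 'p, 'c) functor_data"
  Hor :: "('p \<times> 'p, 'c \<times> 'c, 'p, 'c) functor_data"
  Asc :: "'p \<Rightarrow> 'p \<Rightarrow> 'p \<Rightarrow> 'c"
  Lun :: "'p \<Rightarrow> 'c"
  Run :: "'p \<Rightarrow> 'c"

abbreviation objs :: "('o, 'a, 'p, 'c) dblcat \<Rightarrow> 'o set" where "objs D \<equiv> Obj (D0 D)"
abbreviation arrs :: "('o, 'a, 'p, 'c) dblcat \<Rightarrow> 'a set" where "arrs D \<equiv> Arr (D0 D)"
abbreviation pros :: "('o, 'a, 'p, 'c) dblcat \<Rightarrow> 'p set" where "pros D \<equiv> Obj (D1 D)"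
abbreviation cells :: "('o, 'a, 'p, 'c) dblcat \<Rightarrow> 'c set" where "cells D \<equiv> Arr (D1 D)"

abbreviation psrc :: "('o, 'a, 'p, 'c) dblcat \<Rightarrow> 'p \<Rightarrow> 'o" where "psrc D m \<equiv> onO (Src D) m"
abbreviation ptgt :: "('o, 'a, 'p, 'c) dblcat \<Rightarrow> 'p \<Rightarrow> 'o" where "ptgt D m \<equiv> onO (Tgt D) m"
abbreviation csrc :: "('o, 'a, 'p, 'c) dblcat \<Rightarrow> 'c \<Rightarrow> 'a" where "csrc D \<alpha> \<equiv> onA (Src D) \<alpha>"
abbreviation ctgt :: "('o, 'a, 'p, 'c) dblcat \<Rightarrow> 'c \<Rightarrow> 'a" where "ctgt D \<alpha> \<equiv> onA (Tgt D) \<alpha>"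

abbreviation pid :: "('o, 'a, 'p, 'c) dblcat \<Rightarrow> 'o \<Rightarrow> 'p" where "pid D x \<equiv> onO (Unit D) x"
abbreviation hid :: "('o, 'a, 'p, 'c) dblcat \<Rightarrow> 'a \<Rightarrow> 'c" where "hid D f \<equiv> onA (Unit D) f"

abbreviation vid :: "('o, 'a, 'p, 'c) dblcat \<Rightarrow> 'p \<Rightarrow> 'c" ("\<one>\<index>")
  where "vid D m \<equiv> Idt (D1 D) m"
abbreviation vcomp :: "('o, 'a, 'p, 'c) dblcat \<Rightarrow> 'c \<Rightarrow> 'c \<Rightarrow> 'c" (infixl "\<bullet>\<index>" 70)
  where "vcomp D \<alpha> \<beta> \<equiv> Comp (D1 D) \<alpha> \<beta>"
abbreviation pcomp :: "('o, 'a, 'p, 'c) dblcat \<Rightarrow> 'p \<Rightarrow> 'p \<Rightarrow> 'p" (infixl "\<odot>\<index>" 75)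
  where "pcomp D m n \<equiv> onO (Hor D) (m, n)"
abbreviation hcomp :: "('o, 'a, 'p, 'c) dblcat \<Rightarrow> 'c \<Rightarrow> 'c \<Rightarrow> 'c" (infixl "\<otimes>\<index>" 75)
  where "hcomp D \<alpha> \<beta> \<equiv> onA (Hor D) (\<alpha>, \<beta>)"

text \<open>The pullback of \<open>Tgt\<close> and \<open>Src\<close>, i.e. the category of externally composable pairs.\<close>

definition pairs :: "('o, 'a, 'p, 'c) dblcat \<Rightarrow> ('p \<times> 'p, 'c \<times> 'c) cat" where
  "pairs D = \<lparr>
    Obj = {(m, n). m \<in> pros D \<and> n \<in> pros D \<and> ptgt D m = psrc D n},
    Arr = {(\<alpha>, \<beta>). \<alpha> \<in> cells D \<and> \<beta> \<in> cells D \<and> ctgt D \<alpha> = csrc D \<beta>},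
    Dom = (\<lambda>(\<alpha>, \<beta>). (Dom (D1 D) \<alpha>, Dom (D1 D) \<beta>)),
    Cod = (\<lambda>(\<alpha>, \<beta>). (Cod (D1 D) \<alpha>, Cod (D1 D) \<beta>)),
    Idt = (\<lambda>(m, n). (vid D m, vid D n)),
    Comp = (\<lambda>(\<alpha>, \<beta>) (\<alpha>', \<beta>'). (vcomp D \<alpha> \<alpha>', vcomp D \<beta> \<beta>')) \<rparr>"

definition cell_over ::
    "('o, 'a, 'p, 'c) dblcat \<Rightarrow> 'p \<Rightarrow> 'p \<Rightarrow> 'a \<Rightarrow> 'a \<Rightarrow> 'c set" where
  "cell_over D m n f g = {\<alpha> \<in> hom (D1 D) m n. csrc D \<alpha> = f \<and> ctgt D \<alpha> = g}"

definition globular :: "('o, 'a, 'p, 'c) dblcat \<Rightarrow> 'p \<Rightarrow> 'p \<Rightarrow> 'c set" where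
  "globular D m n = cell_over D m n (Idt (D0 D) (psrc D m)) (Idt (D0 D) (ptgt D m))"

locale double_category =
  fixes D :: "('o, 'a, 'p, 'c) dblcat" (structure)
  assumes Src_functor: "cat_functor (D1 D) (D0 D) (Src D)"
    and Tgt_functor: "cat_functor (D1 D) (D0 D) (Tgt D)"
    and Unit_functor: "cat_functor (D0 D) (D1 D) (Unit D)"
    and Hor_functor: "cat_functor (pairs D) (D1 D) (Hor D)"
    and pid_ends: "x \<in> objs D \<Longrightarrow> psrc D (pid D x) = x \<and> ptgt D (pid D x) = x"
    and hid_ends: "f \<in> arrs D \<Longrightarrow> csrc D (hid D f) = f \<and> ctgt D (hid D f) = f"
    and pcomp_ends: "m \<in> pros D \<Longrightarrow> n \<in> pros D \<Longrightarrow> ptgt D m = psrc D n \<Longrightarrow>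
      psrc D (m \<odot> n) = psrc D m \<and> ptgt D (m \<odot> n) = ptgt D n"
    and hcomp_ends: "\<alpha> \<in> cells D \<Longrightarrow> \<beta> \<in> cells D \<Longrightarrow> ctgt D \<alpha> = csrc D \<beta> \<Longrightarrow>
      csrc D (\<alpha> \<otimes> \<beta>) = csrc D \<alpha> \<and> ctgt D (\<alpha> \<otimes> \<beta>) = ctgt D \<beta>"
    and Asc_globular: "m \<in> pros D \<Longrightarrow> n \<in> pros D \<Longrightarrow> p \<in> pros D \<Longrightarrow>
      ptgt D m = psrc D n \<Longrightarrow> ptgt D n = psrc D p \<Longrightarrow>
      Asc D m n p \<in> globular D (m \<odot> n \<odot> p) (m \<odot> (n \<odot> p)) \<and> iso_arr (D1 D) (Asc D m n p)"
    and Lun_globular: "m \<in> pros D \<Longrightarrow>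
      Lun D m \<in> globular D (pid D (psrc D m) \<odot> m) m \<and> iso_arr (D1 D) (Lun D m)"
    and Run_globular: "m \<in> pros D \<Longrightarrow>
      Run D m \<in> globular D (m \<odot> pid D (ptgt D m)) m \<and> iso_arr (D1 D) (Run D m)"
    and Asc_natural:
      "\<alpha> \<in> hom (D1 D) m m' \<Longrightarrow> \<beta> \<in> hom (D1 D) n n' \<Longrightarrow> \<gamma> \<in> hom (D1 D) p p' \<Longrightarrow>
      ctgt D \<alpha> = csrc D \<beta> \<Longrightarrow> ctgt D \<beta> = csrc D \<gamma> \<Longrightarrow>
      (\<alpha> \<otimes> \<beta> \<otimes> \<gamma>) \<bullet> Asc D m' n' p' = Asc D m n p \<bullet> (\<alpha> \<otimes> (\<beta> \<otimes> \<gamma>))"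
    and Lun_natural: "\<alpha> \<in> hom (D1 D) m n \<Longrightarrow>
      (hid D (csrc D \<alpha>) \<otimes> \<alpha>) \<bullet> Lun D n = Lun D m \<bullet> \<alpha>"
    and Run_natural: "\<alpha> \<in> hom (D1 D) m n \<Longrightarrow>
      (\<alpha> \<otimes> hid D (ctgt D \<alpha>)) \<bullet> Run D n = Run D m \<bullet> \<alpha>"
    and pentagon:
      "m \<in> pros D \<Longrightarrow> n \<in> pros D \<Longrightarrow> p \<in> pros D \<Longrightarrow> q \<in> pros D \<Longrightarrow>
      ptgt D m = psrc D n \<Longrightarrow> ptgt D n = psrc D p \<Longrightarrow> ptgt D p = psrc D q \<Longrightarrow>
      (Asc D m n p \<otimes> \<one> q) \<bullet> Asc D m (n \<odot> p) q \<bullet> (\<one> m \<otimes> Asc D n p q) =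
      Asc D (m \<odot> n) p q \<bullet> Asc D m n (p \<odot> q)"
    and triangle: "m \<in> pros D \<Longrightarrow> n \<in> pros D \<Longrightarrow> ptgt D m = psrc D n \<Longrightarrow>
      Asc D m (pid D (ptgt D m)) n \<bullet> (\<one> m \<otimes> Lun D n) = Run D m \<otimes> \<one> n"

text \<open>
  Strict associativity and unitality of \<open>\<otimes>\<close> on cells follow from the naturality of the
  coherence cells once these are identities.
\<close>

locale strict_double_category = double_category D
  for D :: "('o, 'a, 'p, 'c) dblcat" (structure) +
  assumes pcomp_assoc: "m \<in> pros D \<Longrightarrow> n \<in> pros D \<Longrightarrow> p \<in> pros D \<Longrightarrow>
      ptgt D m = psrc D n \<Longrightarrow> ptgt D n = psrc D p \<Longrightarrow> m \<odot> n \<odot> p = m \<odot> (n \<odot> p)"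
    and pid_left: "m \<in> pros D \<Longrightarrow> pid D (psrc D m) \<odot> m = m"
    and pid_right: "m \<in> pros D \<Longrightarrow> m \<odot> pid D (ptgt D m) = m"
    and Asc_strict: "m \<in> pros D \<Longrightarrow> n \<in> pros D \<Longrightarrow> p \<in> pros D \<Longrightarrow>
      ptgt D m = psrc D n \<Longrightarrow> ptgt D n = psrc D p \<Longrightarrow> Asc D m n p = \<one> (m \<odot> n \<odot> p)"
    and Lun_strict: "m \<in> pros D \<Longrightarrow> Lun D m = \<one> m"
    and Run_strict: "m \<in> pros D \<Longrightarrow> Run D m = \<one> m"


section \<open>Lax double functors\<close>

record ('o, 'a, 'p, 'c, 'o2, 'a2, 'p2, 'c2) lax_data =
  F0 :: "('o, 'a, 'o2, 'a2) functor_data"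
  F1 :: "('p, 'c, 'p2, 'c2) functor_data"
  lax :: "'p \<Rightarrow> 'p \<Rightarrow> 'c2"
  unt :: "'o \<Rightarrow> 'c2"

locale lax_double_functor = D: double_category D + E: double_category E
  for D :: "('o, 'a, 'p, 'c) dblcat" and E :: "('o2, 'a2, 'p2, 'c2) dblcat" +
  fixes F :: "('o, 'a, 'p, 'c, 'o2, 'a2, 'p2, 'c2) lax_data"
  assumes F0_functor: "cat_functor (D0 D) (D0 E) (F0 F)"
    and F1_functor: "cat_functor (D1 D) (D1 E) (F1 F)"
    and F_ends: "m \<in> pros D \<Longrightarrow>
      psrc E (onO (F1 F) m) = onO (F0 F) (psrc D m) \<and>
      ptgt E (onO (F1 F) m) = onO (F0 F) (ptgt D m)"
    and F_cell_ends: "\<alpha> \<in> cells D \<Longrightarrow>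
      csrc E (onA (F1 F) \<alpha>) = onA (F0 F) (csrc D \<alpha>) \<and>
      ctgt E (onA (F1 F) \<alpha>) = onA (F0 F) (ctgt D \<alpha>)"
    and lax_globular: "m \<in> pros D \<Longrightarrow> n \<in> pros D \<Longrightarrow> ptgt D m = psrc D n \<Longrightarrow>
      lax F m n \<in> globular E (onO (F1 F) m \<odot>\<^bsub>E\<^esub> onO (F1 F) n) (onO (F1 F) (m \<odot>\<^bsub>D\<^esub> n))"
    and unt_globular: "x \<in> objs D \<Longrightarrow>
      unt F x \<in> globular E (pid E (onO (F0 F) x)) (onO (F1 F) (pid D x))"
    and lax_natural:
      "\<alpha> \<in> hom (D1 D) m m' \<Longrightarrow> \<beta> \<in> hom (D1 D) n n' \<Longrightarrow> ctgt D \<alpha> = csrc D \<beta> \<Longrightarrow>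
      (onA (F1 F) \<alpha> \<otimes>\<^bsub>E\<^esub> onA (F1 F) \<beta>) \<bullet>\<^bsub>E\<^esub> lax F m' n' =
      lax F m n \<bullet>\<^bsub>E\<^esub> onA (F1 F) (\<alpha> \<otimes>\<^bsub>D\<^esub> \<beta>)"
    and unt_natural: "f \<in> hom (D0 D) x y \<Longrightarrow>
      hid E (onA (F0 F) f) \<bullet>\<^bsub>E\<^esub> unt F y = unt F x \<bullet>\<^bsub>E\<^esub> onA (F1 F) (hid D f)"
    and lax_assoc:
      "m \<in> pros D \<Longrightarrow> n \<in> pros D \<Longrightarrow> p \<in> pros D \<Longrightarrow>
      ptgt D m = psrc D n \<Longrightarrow> ptgt D n = psrc D p \<Longrightarrow>
      (lax F m n \<otimes>\<^bsub>E\<^esub> \<one>\<^bsub>E\<^esub> (onO (F1 F) p)) \<bullet>\<^bsub>E\<^esub> lax F (m \<odot>\<^bsub>D\<^esub> n) p \<bullet>\<^bsub>E\<^esub> onA (F1 F) (Asc D m n p) =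
      Asc E (onO (F1 F) m) (onO (F1 F) n) (onO (F1 F) p) \<bullet>\<^bsub>E\<^esub>
        (\<one>\<^bsub>E\<^esub> (onO (F1 F) m) \<otimes>\<^bsub>E\<^esub> lax F n p) \<bullet>\<^bsub>E\<^esub> lax F m (n \<odot>\<^bsub>D\<^esub> p)"
    and lax_unit_left: "m \<in> pros D \<Longrightarrow>
      (unt F (psrc D m) \<otimes>\<^bsub>E\<^esub> \<one>\<^bsub>E\<^esub> (onO (F1 F) m)) \<bullet>\<^bsub>E\<^esub>
        lax F (pid D (psrc D m)) m \<bullet>\<^bsub>E\<^esub> onA (F1 F) (Lun D m) =
      Lun E (onO (F1 F) m)"
    and lax_unit_right: "m \<in> pros D \<Longrightarrow>
      (\<one>\<^bsub>E\<^esub> (onO (F1 F) m) \<otimes>\<^bsub>E\<^esub> unt F (ptgt D m)) \<bullet>\<^bsub>E\<^esub>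
        lax F m (pid D (ptgt D m)) \<bullet>\<^bsub>E\<^esub> onA (F1 F) (Run D m) =
      Run E (onO (F1 F) m)"


section \<open>Categories, functors, profunctors and natural transformations in a double category\<close>

text \<open>
  The double category is only pseudo, so the coherence cells that are usually suppressed
  in these axioms are written out.
\<close>

record ('o, 'p, 'c) int_cat =
  iobj :: 'o
  ipro :: 'p
  imul :: 'c
  iunt :: 'c

locale internal_category = double_category E
  for E :: "('o, 'a, 'p, 'c) dblcat" (structure) +
  fixes X :: "('o, 'p, 'c) int_cat"
  assumes iobj_closed: "iobj X \<in> objs E"
    and ipro_closed: "ipro X \<in> pros E" "psrc E (ipro X) = iobj X" "ptgt E (ipro X) = iobj X"
    and imul_globular: "imul X \<in> globular E (ipro X \<odot> ipro X) (ipro X)"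
    and iunt_globular: "iunt X \<in> globular E (pid E (iobj X)) (ipro X)"
    and imul_assoc: "(imul X \<otimes> \<one> (ipro X)) \<bullet> imul X =
      Asc E (ipro X) (ipro X) (ipro X) \<bullet> (\<one> (ipro X) \<otimes> imul X) \<bullet> imul X"
    and imul_unit_left: "(iunt X \<otimes> \<one> (ipro X)) \<bullet> imul X = Lun E (ipro X)"
    and imul_unit_right: "(\<one> (ipro X) \<otimes> iunt X) \<bullet> imul X = Run E (ipro X)"

record ('a, 'c) int_fun =
  farr :: 'a
  fcell :: 'c

locale internal_functor = X: internal_category E X + Y: internal_category E Y
  for E :: "('o, 'a, 'p, 'c) dblcat" (structure)
    and X :: "('o, 'p, 'c) int_cat" and Y :: "('o, 'p, 'c) int_cat" +
  fixes \<Phi> :: "('a, 'c) int_fun"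
  assumes farr_hom: "farr \<Phi> \<in> hom (D0 E) (iobj X) (iobj Y)"
    and fcell_over: "fcell \<Phi> \<in> cell_over E (ipro X) (ipro Y) (farr \<Phi>) (farr \<Phi>)"
    and fcell_mul: "(fcell \<Phi> \<otimes> fcell \<Phi>) \<bullet> imul Y = imul X \<bullet> fcell \<Phi>"
    and fcell_unt: "hid E (farr \<Phi>) \<bullet> iunt Y = iunt X \<bullet> fcell \<Phi>"

record ('o, 'p, 'c) prof =
  prdom :: "('o, 'p, 'c) int_cat"
  prcod :: "('o, 'p, 'c) int_cat"
  prpro :: 'p
  lact :: 'c
  ract :: 'c

locale profunctor = X: internal_category E "prdom P" + Y: internal_category E "prcod P"
  for E :: "('o, 'a, 'p, 'c) dblcat" (structure) and P :: "('o, 'p, 'c) prof" +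
  assumes prpro_closed:
      "prpro P \<in> pros E" "psrc E (prpro P) = iobj (prdom P)" "ptgt E (prpro P) = iobj (prcod P)"
    and lact_globular: "lact P \<in> globular E (ipro (prdom P) \<odot> prpro P) (prpro P)"
    and ract_globular: "ract P \<in> globular E (prpro P \<odot> ipro (prcod P)) (prpro P)"
    and lact_mul: "(imul (prdom P) \<otimes> \<one> (prpro P)) \<bullet> lact P =
      Asc E (ipro (prdom P)) (ipro (prdom P)) (prpro P) \<bullet>
        (\<one> (ipro (prdom P)) \<otimes> lact P) \<bullet> lact P"
    and lact_unt: "(iunt (prdom P) \<otimes> \<one> (prpro P)) \<bullet> lact P = Lun E (prpro P)"
    and ract_mul: "(ract P \<otimes> \<one> (ipro (prcod P))) \<bullet> ract P =
      Asc E (prpro P) (ipro (prcod P)) (ipro (prcod P)) \<bullet>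
        (\<one> (prpro P) \<otimes> imul (prcod P)) \<bullet> ract P"
    and ract_unt: "(\<one> (prpro P) \<otimes> iunt (prcod P)) \<bullet> ract P = Run E (prpro P)"
    and act_compat: "(lact P \<otimes> \<one> (ipro (prcod P))) \<bullet> ract P =
      Asc E (ipro (prdom P)) (prpro P) (ipro (prcod P)) \<bullet>
        (\<one> (ipro (prdom P)) \<otimes> ract P) \<bullet> lact P"

locale natural_transformation =
  P: profunctor E P + Q: profunctor E Q +
  \<Phi>: internal_functor E "prdom P" "prdom Q" \<Phi> + \<Psi>: internal_functor E "prcod P" "prcod Q" \<Psi>
  for E :: "('o, 'a, 'p, 'c) dblcat" (structure)
    and P :: "('o, 'p, 'c) prof" and Q :: "('o, 'p, 'c) prof"
    and \<Phi> :: "('a, 'c) int_fun" and \<Psi> :: "('a, 'c) int_fun" +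
  fixes \<alpha> :: 'c
  assumes cell_over: "\<alpha> \<in> cell_over E (prpro P) (prpro Q) (farr \<Phi>) (farr \<Psi>)"
    and lact_equivariant: "(fcell \<Phi> \<otimes> \<alpha>) \<bullet> lact Q = lact P \<bullet> \<alpha>"
    and ract_equivariant: "(\<alpha> \<otimes> fcell \<Psi>) \<bullet> ract Q = ract P \<bullet> \<alpha>"

text \<open>
  The category of profunctors and natural transformations in \<open>E\<close>. An arrow records its domain and
  codomain profunctors and its source and target functors, since the underlying cell does not
  determine them; all components compose as in \<open>E\<close>.
\<close>

record ('o, 'a, 'p, 'c) nat_tr =
  ntdom :: "('o, 'p, 'c) prof"
  ntcod :: "('o, 'p, 'c) prof"
  ntsrc :: "('a, 'c) int_fun"
  nttgt :: "('a, 'c) int_fun"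
  ntcell :: 'c

definition int_fun_id ::
    "('o, 'a, 'p, 'c) dblcat \<Rightarrow> ('o, 'p, 'c) int_cat \<Rightarrow> ('a, 'c) int_fun" where
  "int_fun_id E X = \<lparr> farr = Idt (D0 E) (iobj X), fcell = vid E (ipro X) \<rparr>"

definition int_fun_comp ::
    "('o, 'a, 'p, 'c) dblcat \<Rightarrow> ('a, 'c) int_fun \<Rightarrow> ('a, 'c) int_fun \<Rightarrow> ('a, 'c) int_fun" where
  "int_fun_comp E \<Phi> \<Psi> =
    \<lparr> farr = Comp (D0 E) (farr \<Phi>) (farr \<Psi>), fcell = vcomp E (fcell \<Phi>) (fcell \<Psi>) \<rparr>"

definition prof_cat ::
    "('o, 'a, 'p, 'c) dblcat \<Rightarrow> (('o, 'p, 'c) prof, ('o, 'a, 'p, 'c) nat_tr) cat" where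
  "prof_cat E = \<lparr>
    Obj = {P. profunctor E P},
    Arr = {\<tau>. natural_transformation E (ntdom \<tau>) (ntcod \<tau>) (ntsrc \<tau>) (nttgt \<tau>) (ntcell \<tau>)},
    Dom = ntdom,
    Cod = ntcod,
    Idt = (\<lambda>P. \<lparr> ntdom = P, ntcod = P,
      ntsrc = int_fun_id E (prdom P), nttgt = int_fun_id E (prcod P), ntcell = vid E (prpro P) \<rparr>),
    Comp = (\<lambda>\<sigma> \<tau>. \<lparr> ntdom = ntdom \<sigma>, ntcod = ntcod \<tau>,
      ntsrc = int_fun_comp E (ntsrc \<sigma>) (ntsrc \<tau>), nttgt = int_fun_comp E (nttgt \<sigma>) (nttgt \<tau>),
      ntcell = vcomp E (ntcell \<sigma>) (ntcell \<tau>) \<rparr>) \<rparr>"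


section \<open>The assignments induced by a lax double functor\<close>

text \<open>
  For strict \<open>D\<close> the cells \<open>lax F (pid D x) m\<close> and \<open>lax F m (pid D y)\<close> have codomain \<open>F m\<close>, because
  \<open>id \<odot> m = m = m \<odot> id\<close> holds on the nose.
\<close>

definition F_cat :: "('o, 'a, 'p, 'c) dblcat \<Rightarrow>
    ('o, 'a, 'p, 'c, 'o2, 'a2, 'p2, 'c2) lax_data \<Rightarrow> 'o \<Rightarrow> ('o2, 'p2, 'c2) int_cat" where
  "F_cat D F x = \<lparr> iobj = onO (F0 F) x, ipro = onO (F1 F) (pid D x),
    imul = lax F (pid D x) (pid D x), iunt = unt F x \<rparr>"

definition F_fun :: "('o, 'a, 'p, 'c) dblcat \<Rightarrow>
    ('o, 'a, 'p, 'c, 'o2, 'a2, 'p2, 'c2) lax_data \<Rightarrow> 'a \<Rightarrow> ('a2, 'c2) int_fun" where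
  "F_fun D F f = \<lparr> farr = onA (F0 F) f, fcell = onA (F1 F) (hid D f) \<rparr>"

definition F_prof :: "('o, 'a, 'p, 'c) dblcat \<Rightarrow>
    ('o, 'a, 'p, 'c, 'o2, 'a2, 'p2, 'c2) lax_data \<Rightarrow> 'p \<Rightarrow> ('o2, 'p2, 'c2) prof" where
  "F_prof D F m = \<lparr> prdom = F_cat D F (psrc D m), prcod = F_cat D F (ptgt D m),
    prpro = onO (F1 F) m,
    lact = lax F (pid D (psrc D m)) m, ract = lax F m (pid D (ptgt D m)) \<rparr>"

definition F_nat :: "('o, 'a, 'p, 'c) dblcat \<Rightarrow>
    ('o, 'a, 'p, 'c, 'o2, 'a2, 'p2, 'c2) lax_data \<Rightarrow> 'c \<Rightarrow> ('o2, 'a2, 'p2, 'c2) nat_tr" where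
  "F_nat D F \<alpha> = \<lparr> ntdom = F_prof D F (Dom (D1 D) \<alpha>), ntcod = F_prof D F (Cod (D1 D) \<alpha>),
    ntsrc = F_fun D F (csrc D \<alpha>), nttgt = F_fun D F (ctgt D \<alpha>), ntcell = onA (F1 F) \<alpha> \<rparr>"

end

theory Submission
  imports Defs
begin

text \<open>
  When the coherence cells of \<open>D\<close> are identities, the associativity and unit laws of \<open>F\<close> at triples
  involving external identities are literally the axioms of internal categories and profunctors.
  Equivariance is naturality of the laxators, since strictness and naturality of \<open>Lun\<close> and \<open>Run\<close>
  give \<open>hid f \<otimes> \<alpha> = \<alpha> = \<alpha> \<otimes> hid g\<close>.
\<close>

section \<open>Cells in a double category\<close>

context category
begin

lemma hom_Obj:
  assumes "f \<in> hom C a b"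
  shows "a \<in> Obj C" and "b \<in> Obj C"
  using assms Dom_closed Cod_closed by (auto simp: hom_def)

end

text \<open>The locale only assumes that its structure maps are functors. The laws of
  \<open>D1\<close> and \<open>D0\<close> are recovered from the domains of \<open>Src\<close> and
  \<open>Unit\<close>, and those of the four functors follow below.\<close>

sublocale double_category \<subseteq> V: category "D1 D"
  using Src_functor by (rule cat_functor.axioms)

sublocale double_category \<subseteq> A: category "D0 D"
  using Unit_functor by (rule cat_functor.axioms)

sublocale double_category \<subseteq> S: cat_functor "D1 D" "D0 D" "Src D"
  by (rule Src_functor)

sublocale double_category \<subseteq> T: cat_functor "D1 D" "D0 D" "Tgt D"
  by (rule Tgt_functor)

sublocale double_category \<subseteq> U: cat_functor "D0 D" "D1 D" "Unit D"
  by (rule Unit_functor)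

sublocale double_category \<subseteq> H: cat_functor "pairs D" "D1 D" "Hor D"
  by (rule Hor_functor)

section \<open>Types of cells and the laws of external composition\<close>

context double_category
begin

lemma cell_over_hom: "\<alpha> \<in> cell_over D m n f g \<Longrightarrow> \<alpha> \<in> hom (D1 D) m n"
  by (simp add: cell_over_def)

lemma cell_over_pros:
  assumes "\<alpha> \<in> cell_over D m n f g"
  shows "m \<in> pros D" and "n \<in> pros D"
  using assms V.hom_Obj by (auto dest: cell_over_hom)

lemma cell_over_ends:
  assumes "\<alpha> \<in> cell_over D m n f g"
  shows "f \<in> hom (D0 D) (psrc D m) (psrc D n)" and "g \<in> hom (D0 D) (ptgt D m) (ptgt D n)"
  using assms S.onA_hom T.onA_hom by (auto simp: cell_over_def)

lemma globularD:
  "\<alpha> \<in> globular D m n \<Longrightarrow> \<alpha> \<in> cell_over D m n (Idt (D0 D) (psrc D m)) (Idt (D0 D) (ptgt D m))"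
  by (simp add: globular_def)

lemma globular_hom: "\<alpha> \<in> globular D m n \<Longrightarrow> \<alpha> \<in> hom (D1 D) m n"
  by (simp add: globular_def cell_over_def)

lemma vid_over: "m \<in> pros D \<Longrightarrow>
    \<one> m \<in> cell_over D m m (Idt (D0 D) (psrc D m)) (Idt (D0 D) (ptgt D m))"
  by (simp add: cell_over_def V.Idt_hom S.onA_Idt T.onA_Idt)

lemma hid_over: "f \<in> hom (D0 D) x y \<Longrightarrow> hid D f \<in> cell_over D (pid D x) (pid D y) f f"
  using U.onA_hom hid_ends by (auto simp: cell_over_def hom_def)

lemma vcomp_over:
  assumes "\<alpha> \<in> cell_over D m n f g" and "\<beta> \<in> cell_over D n p f' g'"
  shows "\<alpha> \<bullet> \<beta> \<in> cell_over D m p (Comp (D0 D) f f') (Comp (D0 D) g g')"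
  using assms by (auto simp: cell_over_def intro: V.Comp_hom S.onA_Comp T.onA_Comp)

text \<open>The shared middle arrow \<open>g\<close> is exactly the pullback condition in
  \<open>pairs D\<close>. Through this lemma the functor laws of \<open>Hor\<close> become laws of
  \<otimes>.\<close>

lemma pairs_hom:
  assumes "\<alpha> \<in> cell_over D m m' f g" and "\<beta> \<in> cell_over D n n' g h"
  shows "(\<alpha>, \<beta>) \<in> hom (pairs D) (m, n) (m', n')"
  using assms by (auto simp: cell_over_def hom_def pairs_def)

lemma hcomp_over:
  assumes "\<alpha> \<in> cell_over D m m' f g" and "\<beta> \<in> cell_over D n n' g h"
  shows "\<alpha> \<otimes> \<beta> \<in> cell_over D (m \<odot> n) (m' \<odot> n') f h"
  using assms H.onA_hom[OF pairs_hom[OF assms]] hcomp_ends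
  by (auto simp: cell_over_def hom_def)

lemma interchange:
  assumes "\<alpha> \<in> cell_over D m m' f g" and "\<beta> \<in> cell_over D n n' g h"
    and "\<alpha>' \<in> cell_over D m' m'' f' g'" and "\<beta>' \<in> cell_over D n' n'' g' h'"
  shows "(\<alpha> \<bullet> \<alpha>') \<otimes> (\<beta> \<bullet> \<beta>') = (\<alpha> \<otimes> \<beta>) \<bullet> (\<alpha>' \<otimes> \<beta>')"
  using H.onA_Comp[OF pairs_hom[OF assms(1,2)] pairs_hom[OF assms(3,4)]]
  by (simp add: pairs_def)

lemma hcomp_vid:
  assumes "m \<in> pros D" and "n \<in> pros D" and "ptgt D m = psrc D n"
  shows "\<one> m \<otimes> \<one> n = \<one> (m \<odot> n)"
  using H.onA_Idt[of "(m, n)"] assms by (simp add: pairs_def)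

lemma pcomp_pros:
  assumes "m \<in> pros D" and "n \<in> pros D" and "ptgt D m = psrc D n"
  shows "m \<odot> n \<in> pros D"
  using H.onO_closed[of "(m, n)"] assms by (simp add: pairs_def)

text \<open>Pasting of two squares, each saying that \<kappa>-cells are compatible with a pair of
  cells: interchange separates the pairs, then the second square and the first are applied in turn.
  With multiplications as \<kappa> this composes internal functors; with actions as \<kappa> it
  composes natural transformations.\<close>

lemma hcomp_equivariant_comp:
  assumes "\<alpha> \<in> cell_over D m m' f g" and "\<beta> \<in> cell_over D n n' g h"
    and "\<alpha>' \<in> cell_over D m' m'' f' g'" and "\<beta>' \<in> cell_over D n' n'' g' h'"
    and "\<kappa> \<in> hom (D1 D) (m \<odot> n) p" and "\<kappa>' \<in> hom (D1 D) (m' \<odot> n') p'"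
    and "\<kappa>'' \<in> hom (D1 D) (m'' \<odot> n'') p''"
    and "\<gamma> \<in> hom (D1 D) p p'" and "\<gamma>' \<in> hom (D1 D) p' p''"
    and 1: "(\<alpha> \<otimes> \<beta>) \<bullet> \<kappa>' = \<kappa> \<bullet> \<gamma>" and 2: "(\<alpha>' \<otimes> \<beta>') \<bullet> \<kappa>'' = \<kappa>' \<bullet> \<gamma>'"
  shows "((\<alpha> \<bullet> \<alpha>') \<otimes> (\<beta> \<bullet> \<beta>')) \<bullet> \<kappa>'' = \<kappa> \<bullet> (\<gamma> \<bullet> \<gamma>')"
proof -
  note h = cell_over_hom[OF hcomp_over[OF assms(1,2)]] cell_over_hom[OF hcomp_over[OF assms(3,4)]]
  have "((\<alpha> \<bullet> \<alpha>') \<otimes> (\<beta> \<bullet> \<beta>')) \<bullet> \<kappa>'' = (\<alpha> \<otimes> \<beta>) \<bullet> (\<kappa>' \<bullet> \<gamma>')"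
    by (simp add: interchange[OF assms(1-4)] V.Comp_assoc[OF h assms(7)] 2)
  also have "\<dots> = \<kappa> \<bullet> \<gamma> \<bullet> \<gamma>'"
    by (simp add: V.Comp_assoc[OF h(1) assms(6,9), symmetric] 1)
  finally show ?thesis
    by (simp add: V.Comp_assoc[OF assms(5,8,9)])
qed

end

section \<open>The category of profunctors and natural transformations\<close>

context internal_category
begin

lemma ipro_over: "\<one> (ipro X) \<in> cell_over E (ipro X) (ipro X) (Idt (D0 E) (iobj X)) (Idt (D0 E) (iobj X))"
  using vid_over[OF ipro_closed(1)] by (simp add: ipro_closed)

lemma internal_functor_id: "internal_functor E X X (int_fun_id E X)"
proof
  show "farr (int_fun_id E X) \<in> hom (D0 E) (iobj X) (iobj X)"
    by (simp add: int_fun_id_def A.Idt_hom iobj_closed)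
  show "fcell (int_fun_id E X) \<in>
      cell_over E (ipro X) (ipro X) (farr (int_fun_id E X)) (farr (int_fun_id E X))"
    using ipro_over by (simp add: int_fun_id_def)
  \<comment> \<open>\<open>hcomp_vid\<close> makes the external composite of two identity cells an
    identity again, so both sides reduce to \<open>imul X\<close>.\<close>
  show "(fcell (int_fun_id E X) \<otimes> fcell (int_fun_id E X)) \<bullet> imul X =
      imul X \<bullet> fcell (int_fun_id E X)"
    using V.Idt_left V.Idt_right globular_hom[OF imul_globular]
    by (simp add: int_fun_id_def hcomp_vid ipro_closed)
  show "hid E (farr (int_fun_id E X)) \<bullet> iunt X = iunt X \<bullet> fcell (int_fun_id E X)"
    using V.Idt_left V.Idt_right globular_hom[OF iunt_globular]
    by (simp add: int_fun_id_def U.onA_Idt iobj_closed)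
qed

end

lemma internal_functor_comp:
  assumes "internal_functor E X Y \<Phi>" and "internal_functor E Y Z \<Psi>"
  shows "internal_functor E X Z (int_fun_comp E \<Phi> \<Psi>)"
proof -
  interpret F: internal_functor E X Y \<Phi> by fact
  interpret G: internal_functor E Y Z \<Psi> by fact
  show ?thesis
  proof
    show "farr (int_fun_comp E \<Phi> \<Psi>) \<in> hom (D0 E) (iobj X) (iobj Z)"
      using F.X.A.Comp_hom[OF F.farr_hom G.farr_hom] by (simp add: int_fun_comp_def)
    show "fcell (int_fun_comp E \<Phi> \<Psi>) \<in>
        cell_over E (ipro X) (ipro Z) (farr (int_fun_comp E \<Phi> \<Psi>)) (farr (int_fun_comp E \<Phi> \<Psi>))"
      using F.X.vcomp_over[OF F.fcell_over G.fcell_over] by (simp add: int_fun_comp_def)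
    show "(fcell (int_fun_comp E \<Phi> \<Psi>) \<otimes>\<^bsub>E\<^esub> fcell (int_fun_comp E \<Phi> \<Psi>)) \<bullet>\<^bsub>E\<^esub> imul Z =
        imul X \<bullet>\<^bsub>E\<^esub> fcell (int_fun_comp E \<Phi> \<Psi>)"
      using F.X.hcomp_equivariant_comp[OF F.fcell_over F.fcell_over G.fcell_over G.fcell_over
          F.X.globular_hom[OF F.X.imul_globular] F.X.globular_hom[OF F.Y.imul_globular]
          F.X.globular_hom[OF G.Y.imul_globular]
          F.X.cell_over_hom[OF F.fcell_over] F.X.cell_over_hom[OF G.fcell_over]
          F.fcell_mul G.fcell_mul]
      by (simp add: int_fun_comp_def)
    have hom: "hid E (farr \<Phi>) \<in> hom (D1 E) (pid E (iobj X)) (pid E (iobj Y))"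
        "hid E (farr \<Psi>) \<in> hom (D1 E) (pid E (iobj Y)) (pid E (iobj Z))"
      using F.X.U.onA_hom F.farr_hom G.farr_hom by auto
    have unt: "iunt X \<in> hom (D1 E) (pid E (iobj X)) (ipro X)"
        "iunt Y \<in> hom (D1 E) (pid E (iobj Y)) (ipro Y)"
        "iunt Z \<in> hom (D1 E) (pid E (iobj Z)) (ipro Z)"
      using F.X.globular_hom F.X.iunt_globular F.Y.iunt_globular G.Y.iunt_globular by auto
    have cell: "fcell \<Phi> \<in> hom (D1 E) (ipro X) (ipro Y)" "fcell \<Psi> \<in> hom (D1 E) (ipro Y) (ipro Z)"
      using F.X.cell_over_hom F.fcell_over G.fcell_over by auto
    \<comment> \<open>The unit square has \<open>hid\<close> in place of an external composite, so
      the pasting is repeated by hand: \<open>hid\<close> preserves composites, then the unit law of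
      \<Psi> is applied, then that of \<Phi>.\<close>
    have "hid E (Comp (D0 E) (farr \<Phi>) (farr \<Psi>)) \<bullet>\<^bsub>E\<^esub> iunt Z =
        hid E (farr \<Phi>) \<bullet>\<^bsub>E\<^esub> (iunt Y \<bullet>\<^bsub>E\<^esub> fcell \<Psi>)"
      by (simp add: F.X.U.onA_Comp[OF F.farr_hom G.farr_hom]
          F.X.V.Comp_assoc[OF hom unt(3)] G.fcell_unt)
    also have "\<dots> = iunt X \<bullet>\<^bsub>E\<^esub> (fcell \<Phi> \<bullet>\<^bsub>E\<^esub> fcell \<Psi>)"
      by (simp add: F.X.V.Comp_assoc[OF hom(1) unt(2) cell(2), symmetric] F.fcell_unt
          F.X.V.Comp_assoc[OF unt(1) cell])
    finally show "hid E (farr (int_fun_comp E \<Phi> \<Psi>)) \<bullet>\<^bsub>E\<^esub> iunt Z =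
        iunt X \<bullet>\<^bsub>E\<^esub> fcell (int_fun_comp E \<Phi> \<Psi>)"
      by (simp add: int_fun_comp_def)
  qed
qed

section \<open>Identity and composite natural transformations\<close>

lemma (in profunctor) natural_transformation_id:
  "natural_transformation E P P (int_fun_id E (prdom P)) (int_fun_id E (prcod P)) (\<one> (prpro P))"
proof -
  interpret \<Phi>: internal_functor E "prdom P" "prdom P" "int_fun_id E (prdom P)"
    by (rule X.internal_functor_id)
  interpret \<Psi>: internal_functor E "prcod P" "prcod P" "int_fun_id E (prcod P)"
    by (rule Y.internal_functor_id)
  show ?thesis
  proof
    show "\<one> (prpro P) \<in> cell_over E (prpro P) (prpro P)
        (farr (int_fun_id E (prdom P))) (farr (int_fun_id E (prcod P)))"
      using X.vid_over[OF prpro_closed(1)] by (simp add: int_fun_id_def prpro_closed)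
    show "(fcell (int_fun_id E (prdom P)) \<otimes> \<one> (prpro P)) \<bullet> lact P = lact P \<bullet> \<one> (prpro P)"
      using X.V.Idt_left X.V.Idt_right X.globular_hom[OF lact_globular]
      by (simp add: int_fun_id_def X.hcomp_vid X.ipro_closed prpro_closed)
    show "(\<one> (prpro P) \<otimes> fcell (int_fun_id E (prcod P))) \<bullet> ract P = ract P \<bullet> \<one> (prpro P)"
      using X.V.Idt_left X.V.Idt_right X.globular_hom[OF ract_globular]
      by (simp add: int_fun_id_def X.hcomp_vid Y.ipro_closed prpro_closed)
  qed
qed

lemma natural_transformation_comp:
  assumes "natural_transformation E P Q \<Phi> \<Psi> \<alpha>" and "natural_transformation E Q R \<Phi>' \<Psi>' \<beta>"
  shows "natural_transformation E P R (int_fun_comp E \<Phi> \<Phi>') (int_fun_comp E \<Psi> \<Psi>') (\<alpha> \<bullet>\<^bsub>E\<^esub> \<beta>)"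
proof -
  interpret M: natural_transformation E P Q \<Phi> \<Psi> \<alpha> by fact
  interpret N: natural_transformation E Q R \<Phi>' \<Psi>' \<beta> by fact
  interpret \<Phi>\<Phi>': internal_functor E "prdom P" "prdom R" "int_fun_comp E \<Phi> \<Phi>'"
    using M.\<Phi>.internal_functor_axioms N.\<Phi>.internal_functor_axioms by (rule internal_functor_comp)
  interpret \<Psi>\<Psi>': internal_functor E "prcod P" "prcod R" "int_fun_comp E \<Psi> \<Psi>'"
    using M.\<Psi>.internal_functor_axioms N.\<Psi>.internal_functor_axioms by (rule internal_functor_comp)
  note hom = M.P.X.globular_hom
  note cell = M.P.X.cell_over_hom[OF M.cell_over] M.P.X.cell_over_hom[OF N.cell_over]
  show ?thesis
  proof
    show "\<alpha> \<bullet>\<^bsub>E\<^esub> \<beta> \<in> cell_over E (prpro P) (prpro R)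
        (farr (int_fun_comp E \<Phi> \<Phi>')) (farr (int_fun_comp E \<Psi> \<Psi>'))"
      using M.P.X.vcomp_over[OF M.cell_over N.cell_over] by (simp add: int_fun_comp_def)
    \<comment> \<open>Both equivariance laws are pastings of squares. The source functor cells are
      the first factor in the left law, the target functor cells the second factor in the right
      law.\<close>
    show "(fcell (int_fun_comp E \<Phi> \<Phi>') \<otimes>\<^bsub>E\<^esub> (\<alpha> \<bullet>\<^bsub>E\<^esub> \<beta>)) \<bullet>\<^bsub>E\<^esub> lact R = lact P \<bullet>\<^bsub>E\<^esub> (\<alpha> \<bullet>\<^bsub>E\<^esub> \<beta>)"
      using M.P.X.hcomp_equivariant_comp[OF M.\<Phi>.fcell_over M.cell_over N.\<Phi>.fcell_over N.cell_over
          hom[OF M.P.lact_globular] hom[OF M.Q.lact_globular] hom[OF N.Q.lact_globular]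
          cell M.lact_equivariant N.lact_equivariant]
      by (simp add: int_fun_comp_def)
    show "((\<alpha> \<bullet>\<^bsub>E\<^esub> \<beta>) \<otimes>\<^bsub>E\<^esub> fcell (int_fun_comp E \<Psi> \<Psi>')) \<bullet>\<^bsub>E\<^esub> ract R = ract P \<bullet>\<^bsub>E\<^esub> (\<alpha> \<bullet>\<^bsub>E\<^esub> \<beta>)"
      using M.P.X.hcomp_equivariant_comp[OF M.cell_over M.\<Psi>.fcell_over N.cell_over N.\<Psi>.fcell_over
          hom[OF M.P.ract_globular] hom[OF M.Q.ract_globular] hom[OF N.Q.ract_globular]
          cell M.ract_equivariant N.ract_equivariant]
      by (simp add: int_fun_comp_def)
  qed
qed

section \<open>Unit and associativity laws of composition\<close>

lemma int_fun_comp_id_left: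
  assumes "internal_functor E X Y \<Phi>"
  shows "int_fun_comp E (int_fun_id E X) \<Phi> = \<Phi>"
proof -
  interpret internal_functor E X Y \<Phi> by fact
  show ?thesis
    using X.A.Idt_left[OF farr_hom] X.V.Idt_left[OF X.cell_over_hom[OF fcell_over]]
    by (simp add: int_fun_comp_def int_fun_id_def)
qed

lemma int_fun_comp_id_right:
  assumes "internal_functor E X Y \<Phi>"
  shows "int_fun_comp E \<Phi> (int_fun_id E Y) = \<Phi>"
proof -
  interpret internal_functor E X Y \<Phi> by fact
  show ?thesis
    using X.A.Idt_right[OF farr_hom] X.V.Idt_right[OF X.cell_over_hom[OF fcell_over]]
    by (simp add: int_fun_comp_def int_fun_id_def)
qed

lemma int_fun_comp_assoc:
  assumes "internal_functor E X Y \<Phi>" and "internal_functor E Y Z \<Psi>" and "internal_functor E Z W \<Xi>"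
  shows "int_fun_comp E (int_fun_comp E \<Phi> \<Psi>) \<Xi> = int_fun_comp E \<Phi> (int_fun_comp E \<Psi> \<Xi>)"
proof -
  interpret F: internal_functor E X Y \<Phi> by fact
  interpret G: internal_functor E Y Z \<Psi> by fact
  interpret H: internal_functor E Z W \<Xi> by fact
  note hom = F.X.cell_over_hom
  show ?thesis
    using F.X.A.Comp_assoc[OF F.farr_hom G.farr_hom H.farr_hom]
      F.X.V.Comp_assoc[OF hom[OF F.fcell_over] hom[OF G.fcell_over] hom[OF H.fcell_over]]
    by (simp add: int_fun_comp_def)
qed

lemma hom_prof_cat:
  "\<tau> \<in> hom (prof_cat E) P Q \<longleftrightarrow>
    natural_transformation E P Q (ntsrc \<tau>) (nttgt \<tau>) (ntcell \<tau>) \<and> ntdom \<tau> = P \<and> ntcod \<tau> = Q"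
  by (auto simp: hom_def prof_cat_def)

context double_category
begin

text \<open>An arrow carries its source and target functors as data, so each law splits into a law
  for \<open>int_fun_comp\<close> on these components and a law of \<open>D1\<close> on the
  underlying cell.\<close>

lemma category_prof_cat: "category (prof_cat D)"
proof
  fix \<tau> assume "\<tau> \<in> Arr (prof_cat D)"
  then interpret natural_transformation D "ntdom \<tau>" "ntcod \<tau>" "ntsrc \<tau>" "nttgt \<tau>" "ntcell \<tau>"
    by (simp add: prof_cat_def)
  show "Dom (prof_cat D) \<tau> \<in> Obj (prof_cat D)" "Cod (prof_cat D) \<tau> \<in> Obj (prof_cat D)"
    by (simp_all add: prof_cat_def P.profunctor_axioms Q.profunctor_axioms)
next
  fix P assume "P \<in> Obj (prof_cat D)"
  then show "Idt (prof_cat D) P \<in> hom (prof_cat D) P P"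
    using profunctor.natural_transformation_id by (auto simp: prof_cat_def hom_def)
next
  fix \<sigma> \<tau> P Q R assume "\<sigma> \<in> hom (prof_cat D) P Q" "\<tau> \<in> hom (prof_cat D) Q R"
  then show "\<sigma> \<cdot>\<^bsub>prof_cat D\<^esub> \<tau> \<in> hom (prof_cat D) P R"
    using natural_transformation_comp by (fastforce simp: prof_cat_def hom_def)
next
  fix \<tau> P Q assume *: "\<tau> \<in> hom (prof_cat D) P Q"
  then interpret natural_transformation D P Q "ntsrc \<tau>" "nttgt \<tau>" "ntcell \<tau>"
    by (simp add: hom_prof_cat)
  have "\<one> (prpro P) \<bullet> ntcell \<tau> = ntcell \<tau>" "ntcell \<tau> \<bullet> \<one> (prpro Q) = ntcell \<tau>"
    using V.Idt_left V.Idt_right cell_over_hom[OF cell_over] by auto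
  moreover have "ntdom \<tau> = P" "ntcod \<tau> = Q"
    using * by (simp_all add: hom_prof_cat)
  ultimately show "Idt (prof_cat D) P \<cdot>\<^bsub>prof_cat D\<^esub> \<tau> = \<tau>"
      "\<tau> \<cdot>\<^bsub>prof_cat D\<^esub> Idt (prof_cat D) Q = \<tau>"
    by (intro nat_tr.equality; simp add: prof_cat_def
        int_fun_comp_id_left[OF \<Phi>.internal_functor_axioms]
        int_fun_comp_id_left[OF \<Psi>.internal_functor_axioms]
        int_fun_comp_id_right[OF \<Phi>.internal_functor_axioms]
        int_fun_comp_id_right[OF \<Psi>.internal_functor_axioms])+
next
  fix \<rho> \<sigma> \<tau> P Q R S
  assume "\<rho> \<in> hom (prof_cat D) P Q" "\<sigma> \<in> hom (prof_cat D) Q R" "\<tau> \<in> hom (prof_cat D) R S"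
  then interpret \<rho>: natural_transformation D P Q "ntsrc \<rho>" "nttgt \<rho>" "ntcell \<rho>"
    + \<sigma>: natural_transformation D Q R "ntsrc \<sigma>" "nttgt \<sigma>" "ntcell \<sigma>"
    + \<tau>: natural_transformation D R S "ntsrc \<tau>" "nttgt \<tau>" "ntcell \<tau>"
    by (simp_all add: hom_prof_cat)
  have "ntcell \<rho> \<bullet> ntcell \<sigma> \<bullet> ntcell \<tau> = ntcell \<rho> \<bullet> (ntcell \<sigma> \<bullet> ntcell \<tau>)"
    using V.Comp_assoc cell_over_hom \<rho>.cell_over \<sigma>.cell_over \<tau>.cell_over by blast
  then show "\<rho> \<cdot>\<^bsub>prof_cat D\<^esub> \<sigma> \<cdot>\<^bsub>prof_cat D\<^esub> \<tau> = \<rho> \<cdot>\<^bsub>prof_cat D\<^esub> (\<sigma> \<cdot>\<^bsub>prof_cat D\<^esub> \<tau>)"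
    by (simp add: prof_cat_def
        int_fun_comp_assoc[OF \<rho>.\<Phi>.internal_functor_axioms \<sigma>.\<Phi>.internal_functor_axioms
          \<tau>.\<Phi>.internal_functor_axioms]
        int_fun_comp_assoc[OF \<rho>.\<Psi>.internal_functor_axioms \<sigma>.\<Psi>.internal_functor_axioms
          \<tau>.\<Psi>.internal_functor_axioms])
qed

end

section \<open>Lax double functors on strict double categories\<close>

context strict_double_category
begin

lemma hid_hcomp:
  assumes "\<alpha> \<in> cell_over D m n f g"
  shows "hid D f \<otimes> \<alpha> = \<alpha>"
proof -
  note m = cell_over_pros[OF assms] and \<alpha> = cell_over_hom[OF assms]
  \<comment> \<open>Naturality of \<open>Lun\<close> equates this cell, followed by an identity,
    with \<alpha>. Cancelling that identity requires the ends to be \<open>m\<close> and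
    \<open>n\<close> themselves, which is where \<open>pid_left\<close> enters.\<close>
  have "hid D f \<otimes> \<alpha> \<in> hom (D1 D) m n"
    using cell_over_hom[OF hcomp_over[OF hid_over[OF cell_over_ends(1)[OF assms]] assms]]
    by (simp add: pid_left m)
  then show ?thesis
    using Lun_natural[OF \<alpha>] V.Idt_left[OF \<alpha>] V.Idt_right assms
    by (simp add: Lun_strict m cell_over_def)
qed

lemma hcomp_hid:
  assumes "\<alpha> \<in> cell_over D m n f g"
  shows "\<alpha> \<otimes> hid D g = \<alpha>"
proof -
  note m = cell_over_pros[OF assms] and \<alpha> = cell_over_hom[OF assms]
  have "\<alpha> \<otimes> hid D g \<in> hom (D1 D) m n"
    using cell_over_hom[OF hcomp_over[OF assms hid_over[OF cell_over_ends(2)[OF assms]]]]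
    by (simp add: pid_right m)
  then show ?thesis
    using Run_natural[OF \<alpha>] V.Idt_left[OF \<alpha>] V.Idt_right assms
    by (simp add: Run_strict m cell_over_def)
qed

end

text \<open>Joins the two hypotheses of the theorem, so that strictness is available for the domain
  only; \<open>E\<close> stays pseudo.\<close>

locale strict_lax_double_functor = lax_double_functor D E F + D: strict_double_category D
  for D :: "('o, 'a, 'p, 'c) dblcat" and E :: "('o2, 'a2, 'p2, 'c2) dblcat"
    and F :: "('o, 'a, 'p, 'c, 'o2, 'a2, 'p2, 'c2) lax_data"

sublocale strict_lax_double_functor \<subseteq> F0: cat_functor "D0 D" "D0 E" "F0 F"
  by (rule F0_functor)

sublocale strict_lax_double_functor \<subseteq> F1: cat_functor "D1 D" "D1 E" "F1 F"
  by (rule F1_functor)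

section \<open>Laws of the laxators and unitors once the coherence of \<open>D\<close> is
  trivial\<close>

context strict_lax_double_functor
begin

lemma F_cell_over:
  assumes "\<alpha> \<in> cell_over D m n f g"
  shows "onA (F1 F) \<alpha> \<in> cell_over E (onO (F1 F) m) (onO (F1 F) n) (onA (F0 F) f) (onA (F0 F) g)"
  using assms F_cell_ends[of \<alpha>] F1.onA_hom[of \<alpha> m n] by (auto simp: cell_over_def hom_def)

text \<open>The final factor of \<open>lax_assoc\<close> is the image of \<open>Asc D m n p\<close>,
  an identity by strictness. Its image is again an identity and cancels on the right, while the
  associator of \<open>E\<close> remains.\<close>

lemma lax_assoc_strict:
  assumes "m \<in> pros D" "n \<in> pros D" "p \<in> pros D" "ptgt D m = psrc D n" "ptgt D n = psrc D p"
  shows "(lax F m n \<otimes>\<^bsub>E\<^esub> \<one>\<^bsub>E\<^esub> (onO (F1 F) p)) \<bullet>\<^bsub>E\<^esub> lax F (m \<odot>\<^bsub>D\<^esub> n) p =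
      Asc E (onO (F1 F) m) (onO (F1 F) n) (onO (F1 F) p) \<bullet>\<^bsub>E\<^esub>
        (\<one>\<^bsub>E\<^esub> (onO (F1 F) m) \<otimes>\<^bsub>E\<^esub> lax F n p) \<bullet>\<^bsub>E\<^esub> lax F m (n \<odot>\<^bsub>D\<^esub> p)"
proof -
  have mn: "m \<odot>\<^bsub>D\<^esub> n \<in> pros D" "ptgt D (m \<odot>\<^bsub>D\<^esub> n) = psrc D p"
    using assms by (simp_all add: D.pcomp_pros D.pcomp_ends)
  have mnp: "m \<odot>\<^bsub>D\<^esub> n \<odot>\<^bsub>D\<^esub> p \<in> pros D"
    using mn assms by (simp add: D.pcomp_pros)
  \<comment> \<open>The target arrow of the laxator is rewritten as the identity on the source of
    \<open>F p\<close>, so that the laxator is visibly composable with the identity cell of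
    \<open>F p\<close>.\<close>
  have l: "lax F m n \<in> cell_over E (onO (F1 F) m \<odot>\<^bsub>E\<^esub> onO (F1 F) n) (onO (F1 F) (m \<odot>\<^bsub>D\<^esub> n))
      (Idt (D0 E) (psrc E (onO (F1 F) m))) (Idt (D0 E) (psrc E (onO (F1 F) p)))"
    using E.globularD[OF lax_globular[of m n]] assms F_ends
    by (simp add: E.pcomp_ends F1.onO_closed)
  have "lax F m n \<otimes>\<^bsub>E\<^esub> \<one>\<^bsub>E\<^esub> (onO (F1 F) p) \<in>
      hom (D1 E) (onO (F1 F) m \<odot>\<^bsub>E\<^esub> onO (F1 F) n \<odot>\<^bsub>E\<^esub> onO (F1 F) p)
        (onO (F1 F) (m \<odot>\<^bsub>D\<^esub> n) \<odot>\<^bsub>E\<^esub> onO (F1 F) p)"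
    using E.cell_over_hom[OF E.hcomp_over[OF l E.vid_over]] assms by (simp add: F1.onO_closed)
  from E.V.Idt_right[OF E.V.Comp_hom[OF this E.globular_hom[OF lax_globular[OF mn(1) assms(3) mn(2)]]]]
  show ?thesis
    using lax_assoc[OF assms] assms by (simp add: D.Asc_strict F1.onA_Idt mnp)
qed

text \<open>The same cancellation, now of the image of \<open>Lun D m\<close>, which is an identity
  cell.\<close>

lemma lax_unit_left_strict:
  assumes m: "m \<in> pros D"
  shows "(unt F (psrc D m) \<otimes>\<^bsub>E\<^esub> \<one>\<^bsub>E\<^esub> (onO (F1 F) m)) \<bullet>\<^bsub>E\<^esub> lax F (pid D (psrc D m)) m =
      Lun E (onO (F1 F) m)"
proof -
  have x: "psrc D m \<in> objs D" using m by (rule D.S.onO_closed)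
  have u: "unt F (psrc D m) \<in> cell_over E (pid E (onO (F0 F) (psrc D m)))
      (onO (F1 F) (pid D (psrc D m)))
      (Idt (D0 E) (onO (F0 F) (psrc D m))) (Idt (D0 E) (psrc E (onO (F1 F) m)))"
    using E.globularD[OF unt_globular[OF x]] F_ends[OF m]
    by (simp add: E.pid_ends F0.onO_closed x)
  \<comment> \<open>The laxator ends at \<open>F m\<close> itself since \<open>pid_left\<close>
    identifies the composite with \<open>m\<close>.\<close>
  have l: "lax F (pid D (psrc D m)) m \<in>
      hom (D1 E) (onO (F1 F) (pid D (psrc D m)) \<odot>\<^bsub>E\<^esub> onO (F1 F) m) (onO (F1 F) m)"
    using E.globular_hom[OF lax_globular[of "pid D (psrc D m)" m]] m x
    by (simp add: D.pid_ends D.pid_left D.U.onO_closed)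
  show ?thesis
    using E.V.Idt_right[OF E.V.Comp_hom[OF
          E.cell_over_hom[OF E.hcomp_over[OF u E.vid_over[OF F1.onO_closed[OF m]]]] l]]
      lax_unit_left[OF m]
    by (simp add: D.Lun_strict F1.onA_Idt m)
qed

lemma lax_unit_right_strict:
  assumes m: "m \<in> pros D"
  shows "(\<one>\<^bsub>E\<^esub> (onO (F1 F) m) \<otimes>\<^bsub>E\<^esub> unt F (ptgt D m)) \<bullet>\<^bsub>E\<^esub> lax F m (pid D (ptgt D m)) =
      Run E (onO (F1 F) m)"
proof -
  have y: "ptgt D m \<in> objs D" using m by (rule D.T.onO_closed)
  have u: "unt F (ptgt D m) \<in> cell_over E (pid E (onO (F0 F) (ptgt D m)))
      (onO (F1 F) (pid D (ptgt D m)))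
      (Idt (D0 E) (ptgt E (onO (F1 F) m))) (Idt (D0 E) (onO (F0 F) (ptgt D m)))"
    using E.globularD[OF unt_globular[OF y]] F_ends[OF m]
    by (simp add: E.pid_ends F0.onO_closed y)
  have l: "lax F m (pid D (ptgt D m)) \<in>
      hom (D1 E) (onO (F1 F) m \<odot>\<^bsub>E\<^esub> onO (F1 F) (pid D (ptgt D m))) (onO (F1 F) m)"
    using E.globular_hom[OF lax_globular[of m "pid D (ptgt D m)"]] m y
    by (simp add: D.pid_ends D.pid_right D.U.onO_closed)
  show ?thesis
    using E.V.Idt_right[OF E.V.Comp_hom[OF
          E.cell_over_hom[OF E.hcomp_over[OF E.vid_over[OF F1.onO_closed[OF m]] u]] l]]
      lax_unit_right[OF m]
    by (simp add: D.Run_strict F1.onA_Idt m)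
qed

text \<open>The last fact makes the laxator at two copies of \<open>pid D x\<close> end at the image
  of \<open>pid D x\<close>, so that it has the type of a multiplication.\<close>

lemma pid_facts:
  assumes "x \<in> objs D"
  shows "pid D x \<in> pros D" "psrc D (pid D x) = x" "ptgt D (pid D x) = x"
    "pid D x \<odot>\<^bsub>D\<^esub> pid D x = pid D x"
proof -
  show p: "pid D x \<in> pros D" "psrc D (pid D x) = x" "ptgt D (pid D x) = x"
    using assms by (simp_all add: D.U.onO_closed D.pid_ends)
  show "pid D x \<odot>\<^bsub>D\<^esub> pid D x = pid D x"
    using D.pid_left[OF p(1)] p by simp
qed

section \<open>The induced categories, functors, profunctors and natural transformations\<close>

lemma internal_category_F_cat:
  assumes "x \<in> objs D"
  shows "internal_category E (F_cat D F x)"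
proof -
  note p = pid_facts[OF assms]
  \<comment> \<open>All three proarrows in the associativity law, and the one in each unit law, are
    taken to be \<open>pid D x\<close>; its idempotence removes the composites.\<close>
  show ?thesis
    using p F_ends[OF p(1)] lax_globular[OF p(1,1)] unt_globular[OF assms]
      lax_assoc_strict[OF p(1,1,1)] lax_unit_left_strict[OF p(1)] lax_unit_right_strict[OF p(1)]
    by unfold_locales (simp_all add: F_cat_def F0.onO_closed F1.onO_closed assms)
qed

text \<open>Compatibility with multiplication is naturality of the laxator at two copies of
  \<open>hid D f\<close>, whose external composite is \<open>hid D f\<close> by
  \<open>hid_hcomp\<close>. Compatibility with units is \<open>unt_natural\<close>.\<close>

lemma internal_functor_F_fun:
  assumes f: "f \<in> hom (D0 D) x y"
  shows "internal_functor E (F_cat D F x) (F_cat D F y) (F_fun D F f)"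
proof -
  have xy: "x \<in> objs D" "y \<in> objs D"
    using D.A.hom_Obj[OF f] .
  note h = D.hid_over[OF f] and p = pid_facts[OF xy(1)] pid_facts[OF xy(2)]
  interpret X: internal_category E "F_cat D F x" by (rule internal_category_F_cat[OF xy(1)])
  interpret Y: internal_category E "F_cat D F y" by (rule internal_category_F_cat[OF xy(2)])
  show ?thesis
    using F_cell_over[OF h] F0.onA_hom[OF f] unt_natural[OF f] D.hid_hcomp[OF h]
      lax_natural[OF D.cell_over_hom[OF h] D.cell_over_hom[OF h]] h
    by unfold_locales (simp_all add: F_cat_def F_fun_def cell_over_def)
qed

lemma profunctor_F_prof:
  assumes m: "m \<in> pros D"
  shows "profunctor E (F_prof D F m)"
proof -
  have xy: "psrc D m \<in> objs D" "ptgt D m \<in> objs D"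
    using m by (simp_all add: D.S.onO_closed D.T.onO_closed)
  note p = pid_facts[OF xy(1)] and q = pid_facts[OF xy(2)]
  have prdom: "prdom (F_prof D F m) = F_cat D F (psrc D m)"
    and prcod: "prcod (F_prof D F m) = F_cat D F (ptgt D m)"
    by (simp_all add: F_prof_def)
  interpret X: internal_category E "prdom (F_prof D F m)"
    unfolding prdom by (rule internal_category_F_cat[OF xy(1)])
  interpret Y: internal_category E "prcod (F_prof D F m)"
    unfolding prcod by (rule internal_category_F_cat[OF xy(2)])
  \<comment> \<open>The associativity law at (id, id, m), (m, id, id) and (id, m, id) gives
    \<open>lact_mul\<close>, \<open>ract_mul\<close> and \<open>act_compat\<close> respectively; the
    two unit laws at \<open>m\<close> give \<open>lact_unt\<close> and
    \<open>ract_unt\<close>.\<close>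
  show ?thesis
    using F_ends[OF m] lax_globular[OF p(1) m] lax_globular[OF m q(1)]
      lax_assoc_strict[OF p(1,1) m] lax_assoc_strict[OF m q(1,1)] lax_assoc_strict[OF p(1) m q(1)]
      lax_unit_left_strict[OF m] lax_unit_right_strict[OF m]
    by unfold_locales
      (simp_all add: F_prof_def F_cat_def F1.onO_closed m p q D.pid_left D.pid_right)
qed

text \<open>Naturality of the laxator is used at \<open>(hid D f, \<alpha>)\<close> and at
  \<open>(\<alpha>, hid D g)\<close>. In both cases the external composite in \<open>D\<close>
  collapses to \<alpha>, which leaves the two equivariance laws.\<close>

lemma natural_transformation_F:
  assumes \<alpha>: "\<alpha> \<in> cell_over D m n f g"
  shows "natural_transformation E (F_prof D F m) (F_prof D F n)
    (F_fun D F f) (F_fun D F g) (onA (F1 F) \<alpha>)"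
proof -
  note mn = D.cell_over_pros[OF \<alpha>] and fg = D.cell_over_ends[OF \<alpha>]
  note hf = D.hid_over[OF fg(1)] and hg = D.hid_over[OF fg(2)]
  interpret P: profunctor E "F_prof D F m" by (rule profunctor_F_prof[OF mn(1)])
  interpret Q: profunctor E "F_prof D F n" by (rule profunctor_F_prof[OF mn(2)])
  interpret \<Phi>: internal_functor E "prdom (F_prof D F m)" "prdom (F_prof D F n)" "F_fun D F f"
    using internal_functor_F_fun[OF fg(1)] by (simp add: F_prof_def)
  interpret \<Psi>: internal_functor E "prcod (F_prof D F m)" "prcod (F_prof D F n)" "F_fun D F g"
    using internal_functor_F_fun[OF fg(2)] by (simp add: F_prof_def)
  have "ctgt D (hid D f) = csrc D \<alpha>" "ctgt D \<alpha> = csrc D (hid D g)"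
    using \<alpha> hf hg by (simp_all add: cell_over_def)
  then show ?thesis
    using F_cell_over[OF \<alpha>] D.hid_hcomp[OF \<alpha>] D.hcomp_hid[OF \<alpha>]
      lax_natural[OF D.cell_over_hom[OF hf] D.cell_over_hom[OF \<alpha>]]
      lax_natural[OF D.cell_over_hom[OF \<alpha>] D.cell_over_hom[OF hg]]
    by unfold_locales (simp_all add: F_prof_def F_fun_def)
qed

section \<open>Functoriality of the assignments\<close>

lemma F_fun_Idt:
  assumes "x \<in> objs D"
  shows "F_fun D F (Idt (D0 D) x) = int_fun_id E (F_cat D F x)"
  using assms pid_facts[OF assms]
  by (simp add: F_fun_def int_fun_id_def F_cat_def F0.onA_Idt F1.onA_Idt D.U.onA_Idt)

lemma F_fun_Comp:
  assumes "f \<in> hom (D0 D) x y" and "g \<in> hom (D0 D) y z"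
  shows "F_fun D F (f \<cdot>\<^bsub>D0 D\<^esub> g) = int_fun_comp E (F_fun D F f) (F_fun D F g)"
  using F0.onA_Comp[OF assms] D.U.onA_Comp[OF assms]
    F1.onA_Comp[OF D.U.onA_hom[OF assms(1)] D.U.onA_hom[OF assms(2)]]
  by (simp add: F_fun_def int_fun_comp_def)

text \<open>Identities and composites in \<open>prof_cat E\<close> also involve the source and
  target functors. Besides functoriality of \<open>F1\<close> on cells, the proof therefore needs
  \<open>F_fun_Idt\<close> and \<open>F_fun_Comp\<close>, applied along \<open>Src\<close> and
  \<open>Tgt\<close>.\<close>

lemma cat_functor_F: "cat_functor (D1 D) (prof_cat E) \<lparr> onO = F_prof D F, onA = F_nat D F \<rparr>"
proof -
  interpret P: category "prof_cat E" by (rule E.category_prof_cat)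
  show ?thesis
  proof (unfold_locales, simp_all only: functor_data.simps)
    show "F_prof D F m \<in> Obj (prof_cat E)" if "m \<in> pros D" for m
      using profunctor_F_prof[OF that] by (simp add: prof_cat_def)
    show "F_nat D F \<alpha> \<in> hom (prof_cat E) (F_prof D F m) (F_prof D F n)"
      if "\<alpha> \<in> hom (D1 D) m n" for \<alpha> m n
      using natural_transformation_F[of \<alpha> m n "csrc D \<alpha>" "ctgt D \<alpha>"] that
      by (simp add: hom_prof_cat F_nat_def cell_over_def) (simp add: hom_def)
    show "F_nat D F (\<one>\<^bsub>D\<^esub> m) = Idt (prof_cat E) (F_prof D F m)" if m: "m \<in> pros D" for m
      using m D.V.Idt_hom[OF m]
      by (simp add: F_nat_def prof_cat_def F_prof_def hom_def D.S.onA_Idt D.T.onA_Idt F1.onA_Idt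
          F_fun_Idt D.S.onO_closed D.T.onO_closed)
    show "F_nat D F (\<alpha> \<bullet>\<^bsub>D\<^esub> \<beta>) = F_nat D F \<alpha> \<cdot>\<^bsub>prof_cat E\<^esub> F_nat D F \<beta>"
      if \<alpha>: "\<alpha> \<in> hom (D1 D) m n" and \<beta>: "\<beta> \<in> hom (D1 D) n p" for \<alpha> \<beta> m n p
      using D.V.Comp_hom[OF \<alpha> \<beta>] \<alpha> \<beta> F1.onA_Comp[OF \<alpha> \<beta>] D.S.onA_Comp[OF \<alpha> \<beta>] D.T.onA_Comp[OF \<alpha> \<beta>]
        F_fun_Comp[OF D.S.onA_hom[OF \<alpha>] D.S.onA_hom[OF \<beta>]]
        F_fun_Comp[OF D.T.onA_hom[OF \<alpha>] D.T.onA_hom[OF \<beta>]]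
      by (simp add: F_nat_def prof_cat_def) (simp add: hom_def)
  qed
qed

end

theorem proposition2p15:
  fixes D :: "('o, 'a, 'p, 'c) dblcat"
    and E :: "('o2, 'a2, 'p2, 'c2) dblcat"
    and F :: "('o, 'a, 'p, 'c, 'o2, 'a2, 'p2, 'c2) lax_data"
  assumes "strict_double_category D"
    and "lax_double_functor D E F"
  shows "(\<forall>m \<in> pros D. profunctor E (F_prof D F m)) \<and>
    (\<forall>m n f g. \<forall>\<alpha> \<in> cell_over D m n f g.
      natural_transformation E (F_prof D F m) (F_prof D F n)
        (F_fun D F f) (F_fun D F g) (onA (F1 F) \<alpha>)) \<and>
    cat_functor (D1 D) (prof_cat E) \<lparr> onO = F_prof D F, onA = F_nat D F \<rparr>"
proof -
  interpret strict_lax_double_functor D E F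
    using assms(2,1) by (rule strict_lax_double_functor.intro)
  show ?thesis
    using profunctor_F_prof natural_transformation_F cat_functor_F by blast
qed

end
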